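(* Let $n\ge 1$ and let $k,\ell$ be integers with $1\le k<\ell$. If $pre_k$ is injective on the set of partitions of $n$ with exactly $\ell$ parts, then $pre_{\ell-k}$ is also injective on the set of partitions of $n$ with exactly $\ell$ parts.
   Context: A partition $\lambda=(\lambda_1,\dots,\lambda_\ell)$ of $n$ is a non-increasing sequence of positive integers summing to $n$; $\ell$ is its number of parts. For $k\ge 1$, $pre_k(\lambda)$ is the partition whose multiset of parts is $\{\lambda_{i_1}\lambda_{i_2}\cdots\lambda_{i_k} : 1\le i_1<i_2<\cdots<i_k\le \ell\}$ if $\ell\ge k$, and is the empty partition if $\ell<k$. *)

theory Defs
  imports "HOL-Library.Multiset"
begin

definition partitions :: "nat \<Rightarrow> nat list set" where
  "partitions n = {xs. sorted_wrt (\<ge>) xs \<and> (\<forall>x\<in>set xs. 0 < x) \<and> sum_list xs = n}"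

(* Strictly increasing index sequences i_1 < ... < i_k are encoded as k-element index sets I,
   with positions counted from 0.  Distinct index sets may give the same product, and each
   contributes its own part.  If length xs < k there is no such I and the result is []. *)
definition pre :: "nat \<Rightarrow> nat list \<Rightarrow> nat list" where
  "pre k xs = rev (sorted_list_of_multiset
     (image_mset (\<lambda>I. \<Prod>i\<in>I. xs ! i) (mset_set {I. I \<subseteq> {..<length xs} \<and> card I = k})))"

end

theory Submission
  imports Defs
begin

text \<open>
  The product \<open>P\<close> of all parts is determined by \<open>pre j\<close> for \<open>1 \<le> j \<le> l\<close>: every part
  occurs in \<open>(l - 1) choose (j - 1)\<close> of the \<open>j\<close>-fold products, so these multiply to a
  positive power of \<open>P\<close>. Complementing index sets turns a \<open>j\<close>-fold product \<open>x\<close> into the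
  \<open>(l - j)\<close>-fold product \<open>P / x\<close>, so \<open>pre j\<close> determines \<open>pre (l - j)\<close>.
\<close>

lemma mset_pre:
  "mset (pre k xs) =
    image_mset (\<lambda>I. \<Prod>i\<in>I. xs ! i) (mset_set {I. I \<subseteq> {..<length xs} \<and> card I = k})"
  by (simp add: pre_def)

text \<open>Removing \<open>a\<close> is a bijection onto the (j - 1)-subsets of
  \<open>A - {a}\<close>. For \<open>j = 0\<close> the truncated \<open>j - 1\<close> would make the
  right side 1 instead of 0.\<close>

lemma card_subsets_containing:
  assumes "finite A" "a \<in> A" "1 \<le> j"
  shows "card {I. I \<subseteq> A \<and> card I = j \<and> a \<in> I} = (card A - 1) choose (j - 1)"
proof -
  have "bij_betw (insert a) {J. J \<subseteq> A - {a} \<and> card J = j - 1} {I. I \<subseteq> A \<and> card I = j \<and> a \<in> I}"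
  proof (rule bij_betw_byWitness[where f' = "\<lambda>I. I - {a}"])
    show "insert a ` {J. J \<subseteq> A - {a} \<and> card J = j - 1} \<subseteq> {I. I \<subseteq> A \<and> card I = j \<and> a \<in> I}"
    proof clarsimp
      fix J assume J: "J \<subseteq> A - {a}" "card J = j - Suc 0"
      then have "finite J" "a \<notin> J"
        using assms(1) by (auto intro: finite_subset)
      then show "a \<in> A \<and> J \<subseteq> A \<and> card (insert a J) = j"
        using J assms by auto
    qed
  qed (auto simp: insert_absorb)
  then have "card {I. I \<subseteq> A \<and> card I = j \<and> a \<in> I} = card {J. J \<subseteq> A - {a} \<and> card J = j - 1}"
    by (simp add: bij_betw_same_card)
  also have "\<dots> = (card A - 1) choose (j - 1)"
    using assms by (simp add: n_subsets)
  finally show ?thesis .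
qed

lemma prod_prod_subsets:
  fixes f :: "'a \<Rightarrow> 'b::comm_semiring_1"
  assumes "finite A" "1 \<le> j"
  shows "(\<Prod>I | I \<subseteq> A \<and> card I = j. \<Prod>i\<in>I. f i) = (\<Prod>i\<in>A. f i) ^ ((card A - 1) choose (j - 1))"
proof -
  let ?S = "{I. I \<subseteq> A \<and> card I = j}"
  have fin: "finite ?S"
    using assms(1) by simp
  \<comment> \<open>The inner index is made to range over all of \<open>A\<close> under the
    condition \<open>i \<in> I\<close>, so that the two products can be exchanged.\<close>
  have "(\<Prod>I\<in>?S. \<Prod>i\<in>I. f i) = (\<Prod>I\<in>?S. \<Prod>i | i \<in> A \<and> i \<in> I. f i)"
    by (intro prod.cong) (auto intro!: prod.cong)
  also have "\<dots> = (\<Prod>i\<in>A. \<Prod>I | I \<in> ?S \<and> i \<in> I. f i)"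
    by (rule prod.swap_restrict[OF fin assms(1)])
  also have "\<dots> = (\<Prod>i\<in>A. f i ^ ((card A - 1) choose (j - 1)))"
    using card_subsets_containing[OF assms(1) _ assms(2)]
    by (intro prod.cong) (simp_all add: conj_assoc)
  finally show ?thesis
    by (simp add: prod_power_distrib)
qed

lemma prod_mset_pre:
  assumes "1 \<le> j"
  shows "prod_mset (mset (pre j xs)) = prod_list xs ^ ((length xs - 1) choose (j - 1))"
  using prod_prod_subsets[OF finite_lessThan assms, where f = "\<lambda>i. xs ! i"]
  by (simp add: mset_pre prod_unfold_prod_mset[symmetric] prod.list_conv_set_nth atLeast0LessThan)

text \<open>The map on the right sees only the value of a product, not its index set, so the
  multiset \<open>mset (pre j xs)\<close> and \<open>prod_list xs\<close> suffice. Positive parts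
  make \<open>div\<close> an exact division by a nonzero number.\<close>

lemma mset_pre_complement:
  assumes "\<forall>x\<in>set xs. 0 < x" "j \<le> length xs"
  shows "mset (pre (length xs - j) xs) = image_mset (\<lambda>x. prod_list xs div x) (mset (pre j xs))"
proof -
  let ?A = "{..<length xs}"
  let ?S = "\<lambda>j. {I. I \<subseteq> ?A \<and> card I = j}"
  have "bij_betw (\<lambda>I. ?A - I) (?S j) (?S (length xs - j))"
    using assms(2)
    by (intro bij_betw_byWitness[where f' = "\<lambda>I. ?A - I"])
      (auto simp: card_Diff_subset finite_subset[OF _ finite_lessThan])
  \<comment> \<open>Complementation is injective, so no multiplicity changes when the index sets are
    reparametrized.\<close>
  then have S: "mset_set (?S (length xs - j)) = image_mset (\<lambda>I. ?A - I) (mset_set (?S j))"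
    by (simp add: bij_betw_def image_mset_mset_set)
  have "(\<Prod>i\<in>?A - I. xs ! i) = prod_list xs div (\<Prod>i\<in>I. xs ! i)" if "I \<subseteq> ?A" for I
  proof -
    have "prod_list xs = (\<Prod>i\<in>?A - I. xs ! i) * (\<Prod>i\<in>I. xs ! i)"
      using prod.subset_diff[OF that, of "\<lambda>i. xs ! i"]
      by (simp add: prod.list_conv_set_nth atLeast0LessThan)
    moreover have "(\<Prod>i\<in>I. xs ! i) > 0"
      using assms(1) that by (intro prod_pos) auto
    ultimately show ?thesis
      by simp
  qed
  then show ?thesis
    by (auto simp: mset_pre S multiset.map_comp intro!: image_mset_cong)
qed

lemma pre_complement_cong:
  assumes "1 \<le> j" "j \<le> length xs" "length ys = length xs"
    and pos: "\<forall>x\<in>set xs. 0 < x" "\<forall>y\<in>set ys. 0 < y"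
    and eq: "pre j xs = pre j ys"
  shows "pre (length xs - j) xs = pre (length xs - j) ys"
proof -
  have "prod_list xs ^ ((length xs - 1) choose (j - 1)) = prod_list ys ^ ((length xs - 1) choose (j - 1))"
    using prod_mset_pre[OF assms(1), of xs] prod_mset_pre[OF assms(1), of ys] eq assms(3) by simp
  \<comment> \<open>A positive exponent makes the power map injective on naturals; the equal lengths
    made the exponents agree.\<close>
  moreover have "0 < (length xs - 1) choose (j - 1)"
    using assms(2) by (simp add: zero_less_binomial_iff)
  ultimately have "prod_list xs = prod_list ys"
    using power_eq_imp_eq_base by blast
  then have "mset (pre (length xs - j) xs) = mset (pre (length xs - j) ys)"
    using mset_pre_complement[OF pos(1), of j] mset_pre_complement[OF pos(2), of j] assms(2,3) eq
    by simp
  \<comment> \<open>\<open>pre\<close> sorts its multiset, so equal multisets give equal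
    lists.\<close>
  then show ?thesis
    by (simp add: pre_def)
qed

theorem theorem1p5:
  fixes n k l :: nat
  assumes "1 \<le> n" and "1 \<le> k" and "k < l"
    and "inj_on (pre k) {xs \<in> partitions n. length xs = l}"
  shows "inj_on (pre (l - k)) {xs \<in> partitions n. length xs = l}"
proof (rule inj_onI)
  fix xs ys
  assume xs: "xs \<in> {xs \<in> partitions n. length xs = l}"
    and ys: "ys \<in> {xs \<in> partitions n. length xs = l}"
    and "pre (l - k) xs = pre (l - k) ys"
  \<comment> \<open>Complementing with \<open>j = l - k\<close> leads back to \<open>k\<close>,
    since \<open>l - (l - k) = k\<close>; \<open>k < l\<close> also gives
    \<open>1 \<le> j\<close>.\<close>
  then have "pre (length xs - (l - k)) xs = pre (length xs - (l - k)) ys"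
    using assms(3) by (intro pre_complement_cong) (auto simp: partitions_def)
  then have "pre k xs = pre k ys"
    using xs assms(3) by simp
  then show "xs = ys"
    using inj_onD[OF assms(4)] xs ys by blast
qed

end
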